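(* Let $\mathcal{A}$ be a finite set of affine hyperplanes in a finite-dimensional vector space $V$, with reduced intersection lattice $L^\ast(\mathcal{A})$ and Möbius function $\mu$ of $L^\ast(\mathcal{A})$. For $X\le Y$ in $L^\ast(\mathcal{A})$ let $\chi(\mathcal{A}_{X,Y},t)=\sum_{Z\in L^\ast(\mathcal{A}),\,X\le Z\le Y}\mu(X,Z)\,t^{\dim Z}$. Then for all $X\le Y$ in $L^\ast(\mathcal{A})$, \[\chi(\mathcal{A}_{X,Y},st)=\sum_{Z\in L^\ast(\mathcal{A});\,X\le Z\le Y}\chi(\mathcal{A}_{X,Z},s)\,\chi(\mathcal{A}_{Z,Y},t).\] In particular, \[\chi(\mathcal{A},st)=\sum_{X\in L(\mathcal{A})}\chi(\mathcal{A}|X,s)\,\chi(\mathcal{A}/X,t).\]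
   Context: $L(\mathcal{A})$ is the set of all nonempty intersections $\bigcap_{H\in\mathcal{B}}H$ for $\mathcal{B}\subseteq\mathcal{A}$ (the empty intersection being $V=\hat 0$), partially ordered by reverse inclusion. $L^\ast(\mathcal{A})=L(\mathcal{A})\cup\{\hat 1\}$ where $\hat 1$ is an added maximum element, with conventions $\dim(\hat 1)=\infty$ and $t^{\infty}=0$. The characteristic polynomial is $\chi(\mathcal{A},t)=\sum_{X\in L(\mathcal{A})}\mu(\hat0,X)t^{\dim X}=\chi(\mathcal{A}_{\hat 0,\hat 1},t)$. For $X\le Y$ in $L^\ast(\mathcal{A})$, $\mathcal{A}_{X,Y}=\{H\cap X: H\in\mathcal{A},\ Y\subseteq H,\ X\not\subseteq H\}$ is an arrangement in $X$, and the polynomial $\chi(\mathcal{A}_{X,Y},t)$ above is its characteristic polynomial (with $\chi(\mathcal{A}_{\hat1,\hat1},t)=0$). For $X\in L(\mathcal{A})$: $\mathcal{A}|X=\mathcal{A}_{\hat0,X}=\{H\in\mathcal{A}: X\subseteq H\}$ and $\mathcal{A}/X=\mathcal{A}_{X,\hat 1}=\{H\cap X: H\in\mathcal{A},\ X\not\subseteq H\}$, so $\chi(\mathcal{A}|X,s)=\sum_{\hat0\le Z\le X}\mu(\hat0,Z)s^{\dim Z}$ and $\chi(\mathcal{A}/X,t)=\sum_{Z\in L^\ast(\mathcal{A}),\,Z\ge X}\mu(X,Z)t^{\dim Z}$. *)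

theory Defs
  imports Complex_Main
begin

text \<open>
  The vector space \<open>V\<close> is the whole type \<open>'v\<close>, over an arbitrary field with
  scalar multiplication \<open>scale\<close>. Flats are sets of vectors ordered by reverse inclusion,
  so \<open>X \<le> Y\<close> in the intersection lattice reads \<open>Y \<subseteq> X\<close>, the minimum is the ambient space
  and the added maximum is the empty set (which is never a flat).
\<close>

definition affine_hyperplane ::
    "('k::field \<Rightarrow> 'v::ab_group_add \<Rightarrow> 'v) \<Rightarrow> 'v set \<Rightarrow> bool" where
  "affine_hyperplane scale H \<longleftrightarrow>
     (\<exists>a W. module.subspace scale W \<and>
            Suc (vector_space.dim scale W) = vector_space.dim scale UNIV \<and>
            H = (\<lambda>w. a + w) ` W)"

text \<open>For a nonempty affine subspace the differences form its direction space.\<close>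

definition flat_dim ::
    "('k::field \<Rightarrow> 'v::ab_group_add \<Rightarrow> 'v) \<Rightarrow> 'v set \<Rightarrow> nat" where
  "flat_dim scale X = vector_space.dim scale {x - y |x y. x \<in> X \<and> y \<in> X}"

text \<open>\<open>t\<close> to the power \<open>dim X\<close>, where the added maximum has \<open>dim = \<infinity>\<close> and \<open>t\<^sup>\<infinity> = 0\<close>.\<close>

definition dim_power ::
    "('k::field \<Rightarrow> 'v::ab_group_add \<Rightarrow> 'v) \<Rightarrow> 'r::comm_ring_1 \<Rightarrow> 'v set \<Rightarrow> 'r" where
  "dim_power scale t X = (if X = {} then 0 else t ^ flat_dim scale X)"

text \<open>
  Arrangements live in an explicit ambient space \<open>E\<close>: the intersection of the empty
  subfamily is \<open>E\<close>.
\<close>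

definition flats :: "'v set \<Rightarrow> 'v set set \<Rightarrow> 'v set set" where
  "flats E A = {X. X \<noteq> {} \<and> (\<exists>B\<subseteq>A. X = E \<inter> \<Inter>B)}"

definition flats_top :: "'v set \<Rightarrow> 'v set set \<Rightarrow> 'v set set" where
  "flats_top E A = insert {} (flats E A)"

text \<open>
  The Moebius function of a finite family \<open>P\<close> of sets ordered by reverse inclusion:
  \<open>\<mu>(X,X) = 1\<close> and \<open>\<mu>(X,Y) = - (\<Sum>X \<le> Z < Y. \<mu>(X,Z))\<close> for \<open>X < Y\<close>.
  The finiteness guard is only there for termination.
\<close>

function mobius :: "'v set set \<Rightarrow> 'v set \<Rightarrow> 'v set \<Rightarrow> int" where
  "mobius P X Y =
     (if finite P \<and> X \<in> P \<and> Y \<in> P \<and> Y \<subseteq> X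
      then if X = Y then 1 else - (\<Sum>Z | Z \<in> P \<and> Z \<subseteq> X \<and> Y \<subset> Z. mobius P X Z)
      else 0)"
  by pat_completeness auto
termination
proof (relation "measure (\<lambda>(P, X, Y). card {Z \<in> P. Y \<subset> Z})", goal_cases)
  case (2 P X Y Z)
  then have "{W \<in> P. Z \<subset> W} \<subset> {W \<in> P. Y \<subset> W}" by blast
  then show ?case using 2 by (auto intro: psubset_card_mono)
qed simp

declare mobius.simps [simp del]

text \<open>The characteristic polynomial of an arrangement \<open>A\<close> in \<open>E\<close>, evaluated at \<open>t\<close>.\<close>

definition characteristic_polynomial ::
    "('k::field \<Rightarrow> 'v::ab_group_add \<Rightarrow> 'v) \<Rightarrow> 'v set \<Rightarrow> 'v set set \<Rightarrow> 'r::comm_ring_1 \<Rightarrow> 'r" where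
  "characteristic_polynomial scale E A t =
     (\<Sum>X\<in>flats E A. of_int (mobius (flats_top E A) E X) * t ^ flat_dim scale X)"

definition interval_polynomial ::
    "('k::field \<Rightarrow> 'v::ab_group_add \<Rightarrow> 'v) \<Rightarrow> 'v set set \<Rightarrow> 'v set \<Rightarrow> 'v set \<Rightarrow>
     'r::comm_ring_1 \<Rightarrow> 'r" where
  "interval_polynomial scale A X Y t =
     (\<Sum>Z | Z \<in> flats_top UNIV A \<and> Y \<subseteq> Z \<and> Z \<subseteq> X.
        of_int (mobius (flats_top UNIV A) X Z) * dim_power scale t Z)"

text \<open>The arrangement \<open>A\<^bsub>X,Y\<^esub>\<close> in \<open>X\<close>, and its special cases \<open>A|X\<close> (in \<open>V\<close>) and \<open>A/X\<close> (in \<open>X\<close>).\<close>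

definition interval_arrangement :: "'v set set \<Rightarrow> 'v set \<Rightarrow> 'v set \<Rightarrow> 'v set set" where
  "interval_arrangement A X Y = {H \<inter> X |H. H \<in> A \<and> Y \<subseteq> H \<and> \<not> X \<subseteq> H}"

definition localization :: "'v set set \<Rightarrow> 'v set \<Rightarrow> 'v set set" where
  "localization A X = {H \<in> A. X \<subseteq> H}"

definition restriction :: "'v set set \<Rightarrow> 'v set \<Rightarrow> 'v set set" where
  "restriction A X = {H \<inter> X |H. H \<in> A \<and> \<not> X \<subseteq> H}"

text \<open>
  Sanity check: the interval polynomial is the characteristic polynomial of
  \<open>A\<^bsub>X,Y\<^esub>\<close>. The arrangement \<open>A/X\<close> may contain the empty set (from hyperplanes
  parallel to \<open>X\<close>), which affects neither side.
\<close>

lemma flats_interval_arrangement: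
  assumes X: "X \<in> flats_top UNIV A" and Y: "Y \<in> flats_top UNIV A" "Y \<subseteq> X"
  shows "flats X (interval_arrangement A X Y) = {Z \<in> flats UNIV A. Y \<subseteq> Z \<and> Z \<subseteq> X}"
    (is "?L = ?R")
proof (intro set_eqI iffI)
  fix Z assume "Z \<in> ?L"
  then obtain B where B: "B \<subseteq> interval_arrangement A X Y" "Z = X \<inter> \<Inter>B" and ne: "Z \<noteq> {}"
    by (auto simp: flats_def)
  from ne B X have "X \<in> flats UNIV A" by (auto simp: flats_top_def)
  then obtain C where C: "C \<subseteq> A" "X = \<Inter>C" by (auto simp: flats_def)
  define D where "D = {H \<in> A. Y \<subseteq> H \<and> H \<inter> X \<in> B}"
  have DB: "H \<inter> X \<in> B" if "H \<in> D" for H using that by (simp add: D_def)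
  have BD: "\<exists>H\<in>D. K = H \<inter> X" if "K \<in> B" for K
  proof -
    from that B(1) have "K \<in> interval_arrangement A X Y" by (rule rev_subsetD)
    then obtain H where "H \<in> A" "Y \<subseteq> H" "K = H \<inter> X"
      unfolding interval_arrangement_def by blast
    with that show ?thesis unfolding D_def by blast
  qed
  have "Z = \<Inter>C \<inter> \<Inter>D"
    unfolding B(2) C(2)[symmetric] using DB BD by blast
  then have "Z = \<Inter>(C \<union> D)" by blast
  moreover have "C \<union> D \<subseteq> A" using C by (auto simp: D_def)
  moreover have "Y \<subseteq> K" if "K \<in> B" for K
  proof -
    from BD[OF that] obtain H where "H \<in> D" "K = H \<inter> X" by blast
    then show ?thesis using Y(2) unfolding D_def by blast
  qed
  then have "Y \<subseteq> Z" unfolding B(2) using Y(2) by blast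
  moreover have "Z \<subseteq> X" unfolding B(2) by (rule Int_lower1)
  ultimately show "Z \<in> ?R" using ne unfolding flats_def mem_Collect_eq Int_UNIV_left by (intro conjI exI[of _ "C \<union> D"]) assumption+
next
  fix Z assume "Z \<in> ?R"
  then obtain B where B: "B \<subseteq> A" "Z = \<Inter>B" and Z: "Z \<noteq> {}" "Y \<subseteq> Z" "Z \<subseteq> X"
    by (auto simp: flats_def)
  define D where "D = {H \<inter> X |H. H \<in> B \<and> \<not> X \<subseteq> H}"
  have "Z \<subseteq> H \<inter> X" if "H \<in> B" for H using that B(2) Z(3) by blast
  then have "Z \<subseteq> X \<inter> \<Inter>D" using Z(3) unfolding D_def by blast
  moreover have "z \<in> H" if "z \<in> X \<inter> \<Inter>D" "H \<in> B" for z H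
    using that unfolding D_def by (cases "X \<subseteq> H") blast+
  then have "X \<inter> \<Inter>D \<subseteq> Z" unfolding B(2) by blast
  ultimately have "Z = X \<inter> \<Inter>D" by (rule subset_antisym)
  moreover have "Y \<subseteq> H" if "H \<in> B" for H using that B(2) Z(2) by blast
  then have "D \<subseteq> interval_arrangement A X Y"
    using B(1) unfolding D_def interval_arrangement_def by blast
  ultimately show "Z \<in> ?L" using Z(1) unfolding flats_def by blast
qed

lemma finite_flats_top: "finite A \<Longrightarrow> finite (flats_top E A)"
proof -
  assume "finite A"
  moreover have "flats E A \<subseteq> (\<lambda>B. E \<inter> \<Inter>B) ` Pow A" by (auto simp: flats_def)
  ultimately show ?thesis unfolding flats_top_def
    by (metis finite_Pow_iff finite_imageI finite_insert finite_subset)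
qed

lemma mobius_cong_interval:
  assumes "finite P" "finite Q"
    and "\<And>W. Z \<subseteq> W \<Longrightarrow> W \<subseteq> X \<Longrightarrow> W \<in> P \<longleftrightarrow> W \<in> Q"
  shows "mobius P X Z = mobius Q X Z"
  using assms
proof (induction P X Z rule: mobius.induct)
  case (1 P X Z)
  have iff: "W \<in> P \<longleftrightarrow> W \<in> Q" if "Z \<subseteq> W" "W \<subseteq> X" for W using 1(4) that by blast
  show ?case
  proof (cases "X \<in> P \<and> Z \<in> P \<and> Z \<subseteq> X \<and> X \<noteq> Z")
    case True
    have "(\<Sum>W | W \<in> P \<and> W \<subseteq> X \<and> Z \<subset> W. mobius P X W) =
          (\<Sum>W | W \<in> Q \<and> W \<subseteq> X \<and> Z \<subset> W. mobius Q X W)"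
    proof (rule sum.cong)
      show "{W. W \<in> P \<and> W \<subseteq> X \<and> Z \<subset> W} = {W. W \<in> Q \<and> W \<subseteq> X \<and> Z \<subset> W}"
        using iff by blast
      fix W assume "W \<in> {W. W \<in> Q \<and> W \<subseteq> X \<and> Z \<subset> W}"
      then show "mobius P X W = mobius Q X W"
        using True 1(2,3) iff by (intro 1(1)) auto
    qed
    then show ?thesis
      using True 1(2,3) iff[of X] iff[of Z] unfolding mobius.simps[of P X Z] mobius.simps[of Q X Z] by simp
  next
    case False
    then show ?thesis
      using 1(2,3) iff[of X] iff[of Z] unfolding mobius.simps[of P X Z] mobius.simps[of Q X Z] by auto
  qed
qed

lemma characteristic_polynomial_interval_arrangement:
  assumes "finite A" and X: "X \<in> flats_top UNIV A" and Y: "Y \<in> flats_top UNIV A" "Y \<subseteq> X"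
  shows "characteristic_polynomial scale X (interval_arrangement A X Y) t =
         interval_polynomial scale A X Y t"
proof -
  let ?B = "interval_arrangement A X Y" and ?P = "flats_top UNIV A"
  have fl: "flats X ?B = {Z \<in> flats UNIV A. Y \<subseteq> Z \<and> Z \<subseteq> X}"
    using flats_interval_arrangement X Y .
  have "?B \<subseteq> (\<lambda>H. H \<inter> X) ` A" by (auto simp: interval_arrangement_def)
  then have finB: "finite ?B" using \<open>finite A\<close> by (meson finite_imageI finite_subset)
  have "interval_polynomial scale A X Y t =
      (\<Sum>Z\<in>flats X ?B. of_int (mobius ?P X Z) * dim_power scale t Z)"
    unfolding interval_polynomial_def
  proof (rule sum.mono_neutral_right)
    show "finite {Z. Z \<in> ?P \<and> Y \<subseteq> Z \<and> Z \<subseteq> X}"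
      using finite_flats_top[OF \<open>finite A\<close>] by simp
    show "flats X ?B \<subseteq> {Z. Z \<in> ?P \<and> Y \<subseteq> Z \<and> Z \<subseteq> X}"
      unfolding fl flats_top_def by blast
    have "Z = {}" if "Z \<in> {Z. Z \<in> ?P \<and> Y \<subseteq> Z \<and> Z \<subseteq> X} - flats X ?B" for Z
      using that unfolding fl flats_top_def by blast
    then show "\<forall>Z\<in>{Z. Z \<in> ?P \<and> Y \<subseteq> Z \<and> Z \<subseteq> X} - flats X ?B.
        of_int (mobius ?P X Z) * dim_power scale t Z = 0"
      unfolding dim_power_def by simp
  qed
  also have "\<dots> = characteristic_polynomial scale X ?B t"
    unfolding characteristic_polynomial_def
  proof (rule sum.cong[OF refl])
    fix Z assume Z: "Z \<in> flats X ?B"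
    have "mobius ?P X Z = mobius (flats_top X ?B) X Z"
    proof (rule mobius_cong_interval)
      fix W assume "Z \<subseteq> W" "W \<subseteq> X"
      then show "W \<in> ?P \<longleftrightarrow> W \<in> flats_top X ?B"
        using Z unfolding flats_top_def fl by blast
    qed (rule finite_flats_top, fact)+
    moreover have "Z \<noteq> {}" using Z unfolding flats_def by blast
    ultimately show "of_int (mobius ?P X Z) * dim_power scale t Z =
        of_int (mobius (flats_top X ?B) X Z) * t ^ flat_dim scale Z"
      by (simp add: dim_power_def)
  qed
  finally show ?thesis by (rule sym)
qed

lemma restriction_eq_interval_arrangement: "restriction A X = interval_arrangement A X {}"
  by (simp add: restriction_def interval_arrangement_def)

lemma localization_eq_interval_arrangement:
  assumes "UNIV \<notin> A"
  shows "localization A X = interval_arrangement A UNIV X"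
proof -
  have "\<not> UNIV \<subseteq> H" if "H \<in> A" for H
  proof
    assume "UNIV \<subseteq> H"
    then have "H = UNIV" by (rule top.extremum_uniqueI)
    with that assms show False by simp
  qed
  then show ?thesis
    unfolding localization_def interval_arrangement_def Int_UNIV_right
    by (intro Collect_cong) metis
qed

end

(* Expand the right-hand side as a sum over X <= W <= Z <= U <= Y. Summing over Z first gives the
   sum of mobius(Z,U) over W <= Z <= U, which vanishes unless W = U, so only the diagonal terms
   mobius(X,W) s^dim(W) t^dim(W) survive. *)
theory Submission
  imports Defs
begin

text \<open>This is the defining recursion of \<open>mobius\<close> with all terms on one side. In
  the incidence algebra of \<open>P\<close> it says that mu is a left inverse of the zeta
  function.\<close>

lemma sum_mobius_right:
  assumes "finite P" "X \<in> P" "Y \<in> P" "Y \<subseteq> X"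
  shows "(\<Sum>Z | Z \<in> P \<and> Y \<subseteq> Z \<and> Z \<subseteq> X. mobius P X Z) = of_bool (X = Y)"
proof (cases "X = Y")
  case True
  then have "{Z. Z \<in> P \<and> Y \<subseteq> Z \<and> Z \<subseteq> X} = {X}"
    using assms by auto
  then show ?thesis
    using True assms mobius.simps[of P X X] by simp
next
  case False
  have "{Z. Z \<in> P \<and> Y \<subseteq> Z \<and> Z \<subseteq> X} = insert Y {Z. Z \<in> P \<and> Z \<subseteq> X \<and> Y \<subset> Z}"
    using assms by auto
  then have "(\<Sum>Z | Z \<in> P \<and> Y \<subseteq> Z \<and> Z \<subseteq> X. mobius P X Z) =
      mobius P X Y + (\<Sum>Z | Z \<in> P \<and> Z \<subseteq> X \<and> Y \<subset> Z. mobius P X Z)"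
    using assms by simp
  then show ?thesis
    using False assms mobius.simps[of P X Y] by simp
qed

text \<open>Both double sums run over the chains
  \<open>Y \<subseteq> V \<subseteq> Z \<subseteq> X\<close>. Transitivity supplies the bound that
  each inner sum leaves out.\<close>

lemma sum_interval_swap:
  fixes f :: "'a set \<Rightarrow> 'a set \<Rightarrow> 'b::comm_monoid_add"
  assumes "finite P"
  shows "(\<Sum>V | V \<in> P \<and> Y \<subseteq> V \<and> V \<subseteq> X. \<Sum>Z | Z \<in> P \<and> V \<subseteq> Z \<and> Z \<subseteq> X. f V Z) =
         (\<Sum>Z | Z \<in> P \<and> Y \<subseteq> Z \<and> Z \<subseteq> X. \<Sum>V | V \<in> P \<and> Y \<subseteq> V \<and> V \<subseteq> Z. f V Z)"
proof -
  let ?I = "{Z. Z \<in> P \<and> Y \<subseteq> Z \<and> Z \<subseteq> X}"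
  have "(\<Sum>V\<in>?I. \<Sum>Z | Z \<in> P \<and> V \<subseteq> Z \<and> Z \<subseteq> X. f V Z) =
        (\<Sum>V\<in>?I. \<Sum>Z | Z \<in> ?I \<and> V \<subseteq> Z. f V Z)"
    by (intro sum.cong refl) auto
  also have "\<dots> = (\<Sum>Z\<in>?I. \<Sum>V | V \<in> ?I \<and> V \<subseteq> Z. f V Z)"
    using assms by (intro sum.swap_restrict) auto
  also have "\<dots> = (\<Sum>Z\<in>?I. \<Sum>V | V \<in> P \<and> Y \<subseteq> V \<and> V \<subseteq> Z. f V Z)"
    by (intro sum.cong refl) auto
  finally show ?thesis .
qed

text \<open>The recursion of \<open>mobius\<close> varies the second argument, so summing over the
  first one needs a proof: the left inverse of zeta is also a right inverse.\<close>

lemma sum_mobius_left: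
  assumes "finite P" "X \<in> P" "Y \<in> P" "Y \<subseteq> X"
  shows "(\<Sum>Z | Z \<in> P \<and> Y \<subseteq> Z \<and> Z \<subseteq> X. mobius P Z Y) = of_bool (X = Y)"
proof -
  define g where "g V = (\<Sum>Z | Z \<in> P \<and> V \<subseteq> Z \<and> Z \<subseteq> X. mobius P Z V)" for V
  \<comment> \<open>\<open>g V\<close> is the value of zeta * mu at the pair \<open>X\<close>,
    \<open>V\<close>. Convolving once more with zeta gives zeta * (mu * zeta) = zeta, whose value on
    comparable pairs is 1.\<close>
  have total: "(\<Sum>V | V \<in> P \<and> Y \<subseteq> V \<and> V \<subseteq> X. g V) = 1"
    if "Y \<in> P" "Y \<subseteq> X" for Y
  proof -
    have "(\<Sum>V | V \<in> P \<and> Y \<subseteq> V \<and> V \<subseteq> X. g V) =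
          (\<Sum>Z | Z \<in> P \<and> Y \<subseteq> Z \<and> Z \<subseteq> X. \<Sum>V | V \<in> P \<and> Y \<subseteq> V \<and> V \<subseteq> Z. mobius P Z V)"
      unfolding g_def by (rule sum_interval_swap[OF \<open>finite P\<close>])
    also have "\<dots> = (\<Sum>Z | Z \<in> P \<and> Y \<subseteq> Z \<and> Z \<subseteq> X. of_bool (Z = Y))"
      using sum_mobius_right[OF \<open>finite P\<close> _ \<open>Y \<in> P\<close>] by (intro sum.cong refl) auto
    also have "\<dots> = (\<Sum>Z\<in>{Y}. of_bool (Z = Y))"
      using that \<open>finite P\<close> by (intro sum.mono_neutral_right) auto
    finally show ?thesis by simp
  qed
  \<comment> \<open>The indicator of \<open>X\<close> has the same sums over the intervals starting at \<open>X\<close>,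
    and a function is determined by these sums.\<close>
  have "g Y = of_bool (X = Y)"
    using assms(3,4)
  \<comment> \<open>The measure counts the elements strictly below \<open>Y\<close> in the lattice
    order, so the hypothesis covers every other element of the interval from \<open>X\<close> to
    \<open>Y\<close>.\<close>
  proof (induction "card {Z \<in> P. Y \<subset> Z}" arbitrary: Y rule: less_induct)
    case less
    let ?J = "{V. V \<in> P \<and> Y \<subset> V \<and> V \<subseteq> X}"
    have "g V = of_bool (X = V)" if "V \<in> ?J" for V
    proof (rule less.hyps)
      have "{Z \<in> P. V \<subset> Z} \<subset> {Z \<in> P. Y \<subset> Z}" using that by blast
      then show "card {Z \<in> P. V \<subset> Z} < card {Z \<in> P. Y \<subset> Z}"
        using \<open>finite P\<close> by (simp add: psubset_card_mono)
    qed (use that in auto)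
    then have "sum g ?J = (\<Sum>V\<in>?J. of_bool (X = V))"
      by (intro sum.cong refl) auto
    also have "\<dots> = (if X \<in> ?J then 1 else 0)"
      using \<open>finite P\<close> sum.delta'[of ?J X "\<lambda>_. 1::int"] by (simp add: of_bool_def)
    \<comment> \<open>For \<open>X = Y\<close> the set \<open>?J\<close> is empty; otherwise
      \<open>X\<close> lies in it and contributes the only 1.\<close>
    finally have "sum g ?J = of_bool (X \<noteq> Y)"
      using less.prems \<open>X \<in> P\<close> by auto
    moreover have "{V. V \<in> P \<and> Y \<subseteq> V \<and> V \<subseteq> X} = insert Y ?J"
      using less.prems by auto
    then have "g Y + sum g ?J = 1"
      using total[OF less.prems] \<open>finite P\<close> by simp
    ultimately show ?case by (cases "X = Y") simp_all
  qed
  then show ?thesis unfolding g_def .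
qed

text \<open>At the added maximum the convention t^\<infinity> = 0 makes this 0 = 0 * 0.\<close>

lemma dim_power_mult: "dim_power scale (s * t) X = dim_power scale s X * dim_power scale t X"
  by (simp add: dim_power_def power_mult_distrib)

lemma interval_polynomial_mult:
  fixes s t :: "'r::comm_ring_1"
  assumes "finite A" and X: "X \<in> flats_top UNIV A" and Y: "Y \<in> flats_top UNIV A" "Y \<subseteq> X"
  shows "interval_polynomial scale A X Y (s * t) =
    (\<Sum>Z | Z \<in> flats_top UNIV A \<and> Y \<subseteq> Z \<and> Z \<subseteq> X.
       interval_polynomial scale A X Z s * interval_polynomial scale A Z Y t)"
proof -
  let ?P = "flats_top UNIV A" and ?d = "dim_power scale"
  let ?I = "\<lambda>X Y. {Z. Z \<in> ?P \<and> Y \<subseteq> Z \<and> Z \<subseteq> X}"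
  let ?m = "\<lambda>X Y. of_int (mobius ?P X Y) :: 'r"
  let ?q = "\<lambda>Z. interval_polynomial scale A Z Y t"
  have fin: "finite ?P" by (rule finite_flats_top[OF \<open>finite A\<close>])
  \<comment> \<open>Moebius inversion in the lower endpoint: summing the interval polynomials over
    all \<open>Z\<close> above \<open>W\<close> recovers the weight of \<open>W\<close>
    itself.\<close>
  have q: "(\<Sum>Z\<in>?I W Y. ?q Z) = ?d t W" if W: "W \<in> ?I X Y" for W
  proof -
    have "(\<Sum>Z\<in>?I W Y. ?q Z) = (\<Sum>U\<in>?I W Y. \<Sum>Z\<in>?I W U. ?m Z U * ?d t U)"
      unfolding interval_polynomial_def by (rule sum_interval_swap[OF fin, symmetric])
    also have "\<dots> = (\<Sum>U\<in>?I W Y. of_int (\<Sum>Z\<in>?I W U. mobius ?P Z U) * ?d t U)"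
      by (simp add: sum_distrib_right)
    also have "\<dots> = (\<Sum>U\<in>?I W Y. of_int (of_bool (W = U)) * ?d t U)"
      using W by (intro sum.cong refl arg_cong2[of _ _ _ _ "(*)"] arg_cong[of _ _ of_int]
          sum_mobius_left fin) auto
    also have "\<dots> = (\<Sum>U\<in>{W}. of_int (of_bool (W = U)) * ?d t U)"
      using W fin by (intro sum.mono_neutral_right) auto
    finally show ?thesis by simp
  qed
  have "(\<Sum>Z\<in>?I X Y. interval_polynomial scale A X Z s * ?q Z) =
        (\<Sum>Z\<in>?I X Y. \<Sum>W\<in>?I X Z. ?m X W * ?d s W * ?q Z)"
    by (simp add: interval_polynomial_def[of scale A X _ s] sum_distrib_right)
  \<comment> \<open>With \<open>W\<close> outermost, the factor in front of \<open>?q Z\<close> is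
    constant in the inner sum, and what remains there is the sum evaluated by
    \<open>q\<close>.\<close>
  also have "\<dots> = (\<Sum>W\<in>?I X Y. \<Sum>Z\<in>?I W Y. ?m X W * ?d s W * ?q Z)"
    by (rule sum_interval_swap[OF fin])
  also have "\<dots> = (\<Sum>W\<in>?I X Y. ?m X W * ?d s W * ?d t W)"
    by (intro sum.cong refl) (simp only: q flip: sum_distrib_left)
  also have "\<dots> = interval_polynomial scale A X Y (s * t)"
    by (simp add: interval_polynomial_def dim_power_mult mult.assoc)
  finally show ?thesis by (rule sym)
qed

text \<open>If a translate of \<open>W\<close> is everything, then so is \<open>W\<close>, against
  its codimension 1. A member \<open>UNIV\<close> would be kept by \<open>localization\<close> but
  dropped by \<open>interval_arrangement\<close>.\<close>

lemma UNIV_not_affine_hyperplane: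
  fixes scale :: "'k::field \<Rightarrow> 'v::ab_group_add \<Rightarrow> 'v"
  shows "\<not> affine_hyperplane scale UNIV"
proof
  assume "affine_hyperplane scale UNIV"
  then obtain a W where W: "Suc (vector_space.dim scale W) = vector_space.dim scale UNIV"
      "UNIV = (\<lambda>w. a + w) ` W"
    unfolding affine_hyperplane_def by blast
  have "w \<in> W" for w
  proof -
    have "a + w \<in> (\<lambda>w. a + w) ` W" using W(2) by blast
    then show ?thesis by auto
  qed
  then have "W = UNIV" by blast
  with W(1) show False by simp
qed

theorem theorem2p1:
  fixes scale :: "'k::field \<Rightarrow> 'v::ab_group_add \<Rightarrow> 'v"
    and Basis :: "'v set"
    and A :: "'v set set"
    and s t :: "'r::comm_ring_1"
  assumes "finite_dimensional_vector_space scale Basis"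
    and "finite A"
    and "\<forall>H\<in>A. affine_hyperplane scale H"
  shows "(\<forall>X \<in> flats_top UNIV A. \<forall>Y \<in> flats_top UNIV A. Y \<subseteq> X \<longrightarrow>
            interval_polynomial scale A X Y (s * t) =
              (\<Sum>Z | Z \<in> flats_top UNIV A \<and> Y \<subseteq> Z \<and> Z \<subseteq> X.
                 interval_polynomial scale A X Z s * interval_polynomial scale A Z Y t)) \<and>
         characteristic_polynomial scale UNIV A (s * t) =
           (\<Sum>X \<in> flats UNIV A.
              characteristic_polynomial scale UNIV (localization A X) s *
              characteristic_polynomial scale X (restriction A X) t)"
proof (intro conjI ballI impI)
  fix X Y assume "X \<in> flats_top UNIV A" "Y \<in> flats_top UNIV A" "Y \<subseteq> X"
  with \<open>finite A\<close> show "interval_polynomial scale A X Y (s * t) =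
      (\<Sum>Z | Z \<in> flats_top UNIV A \<and> Y \<subseteq> Z \<and> Z \<subseteq> X.
         interval_polynomial scale A X Z s * interval_polynomial scale A Z Y t)"
    by (rule interval_polynomial_mult)
next
  let ?p = "interval_polynomial scale A" and ?c = "characteristic_polynomial scale"
  have noU: "UNIV \<notin> A" using assms(3) UNIV_not_affine_hyperplane by blast
  \<comment> \<open>The minimum is the intersection of the empty subfamily; the empty set is the
    added maximum.\<close>
  have P: "UNIV \<in> flats_top UNIV A" "{} \<in> flats_top UNIV A"
    unfolding flats_top_def flats_def by (auto intro: exI[of _ "{}"])
  have loc: "?c UNIV (localization A X) r = ?p UNIV X r" if "X \<in> flats_top UNIV A" for X and r :: 'r
    using that characteristic_polynomial_interval_arrangement[OF \<open>finite A\<close> P(1)]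
    by (simp add: localization_eq_interval_arrangement[OF noU])
  have res: "?c X (restriction A X) r = ?p X {} r" if "X \<in> flats_top UNIV A" for X and r :: 'r
    using that characteristic_polynomial_interval_arrangement[OF \<open>finite A\<close> _ P(2)]
    by (simp add: restriction_eq_interval_arrangement)
  \<comment> \<open>Viewing \<open>A\<close> as its own localization at the added maximum lets
    \<open>loc\<close> turn its polynomial into that of the whole lattice.\<close>
  have "localization A {} = A" by (simp add: localization_def)
  then have "?c UNIV A (s * t) = ?p UNIV {} (s * t)"
    using loc[OF P(2)] by simp
  also have "\<dots> = (\<Sum>Z \<in> flats_top UNIV A. ?p UNIV Z s * ?p Z {} t)"
    using interval_polynomial_mult[OF \<open>finite A\<close> P] by simp
  \<comment> \<open>Only the added maximum is dropped; its second factor is 0 because t^\<infinity>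
    = 0.\<close>
  also have "\<dots> = (\<Sum>Z \<in> flats UNIV A. ?p UNIV Z s * ?p Z {} t)"
  proof (rule sum.mono_neutral_right)
    have "?p {} {} t = 0"
      by (simp add: interval_polynomial_def dim_power_def)
    then show "\<forall>Z \<in> flats_top UNIV A - flats UNIV A. ?p UNIV Z s * ?p Z {} t = 0"
      by (auto simp: flats_top_def)
  qed (use finite_flats_top[OF \<open>finite A\<close>] in \<open>auto simp: flats_top_def\<close>)
  also have "\<dots> = (\<Sum>X \<in> flats UNIV A. ?c UNIV (localization A X) s * ?c X (restriction A X) t)"
    by (intro sum.cong refl) (simp add: loc res flats_top_def)
  finally show "?c UNIV A (s * t) =
      (\<Sum>X \<in> flats UNIV A. ?c UNIV (localization A X) s * ?c X (restriction A X) t)" .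
qed

end
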